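(* Let $\mu$ be a finite absolutely continuous Borel measure on $\mathbb{R}^n$ with bounded first moment. Then for every $x\in \mathrm{int}(\mathrm{conv}(\mathrm{supp}(\mu)))$ with $x\neq b_\mu(\mathbb{R}^n)$ there exists a halfspace $\mathcal{H}\subset\mathbb{R}^n$ which maximizes $\mu$ among all subsets whose barycenter is $x$, that is, $b_\mu(\mathcal{H})=x$ and $\mu(\mathcal{H})=\sup\{\mu(A) : b_\mu(A)=x\}$. Moreover, if $\partial\mathcal{H}\cap \mathrm{int}(\mathrm{supp}(\mu))\neq\emptyset$, then $\mathcal{H}$ is the unique halfspace for which $b_\mu(\mathcal{H})=x$.
   Context: Absolutely continuous means with respect to Lebesgue measure on $\mathbb{R}^n$. Bounded first moment means $\int_{\mathbb{R}^n}\|x\|\,d\mu(x)<\infty$. For a measurable set $A\subset\mathbb{R}^n$ with $\mu(A)>0$, the barycenter of $A$ with respect to $\mu$ is $b_\mu(A)=\frac{1}{\mu(A)}\int_A x\,d\mu(x)$; the condition $b_\mu(A)=x$ presupposes that $A$ is measurable and $\mu(A)>0$. The support of $\mu$ is denoted $\mathrm{supp}(\mu)$; $\mathrm{int}$ and $\mathrm{conv}$ denote interior and convex hull. Halfspaces are closed: sets of the form $\{y\in\mathbb{R}^n : \langle y,\theta\rangle\le c\}$ with $\theta\in\mathbb{S}^{n-1}$, $c\in\mathbb{R}$. *)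

theory Defs
  imports "HOL-Analysis.Analysis"
begin

definition measure_support :: "'a::topological_space measure \<Rightarrow> 'a set" where
  "measure_support \<mu> = {x. \<forall>U. open U \<and> x \<in> U \<longrightarrow> emeasure \<mu> U > 0}"

definition barycenter :: "'a::euclidean_space measure \<Rightarrow> 'a set \<Rightarrow> 'a" where
  "barycenter \<mu> A = (1 / measure \<mu> A) *\<^sub>R (LINT x:A|\<mu>. x)"

text \<open>
  \<^const>\<open>barycenter\<close> is total, with junk values on non-measurable sets and on sets of measure zero;
  the relational form carries the side conditions under which the barycenter is defined.
\<close>

definition has_barycenter :: "'a::euclidean_space measure \<Rightarrow> 'a set \<Rightarrow> 'a \<Rightarrow> bool" where
  "has_barycenter \<mu> A x \<longleftrightarrow> A \<in> sets \<mu> \<and> measure \<mu> A > 0 \<and> barycenter \<mu> A = x"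

definition closed_halfspace :: "'a::euclidean_space set \<Rightarrow> bool" where
  "closed_halfspace H \<longleftrightarrow> (\<exists>\<theta> c. norm \<theta> = 1 \<and> H = {y. y \<bullet> \<theta> \<le> c})"

definition maximal_halfspace :: "'a::euclidean_space measure \<Rightarrow> 'a \<Rightarrow> 'a set \<Rightarrow> bool" where
  "maximal_halfspace \<mu> x H \<longleftrightarrow>
     closed_halfspace H \<and> has_barycenter \<mu> H x \<and>
     measure \<mu> H = (SUP A\<in>{A. has_barycenter \<mu> A x}. measure \<mu> A)"

end

theory Submission
  imports Defs
begin

text \<open>
  Put \<open>F v = \<integral> max 0 (1 - (y - x) \<bullet> v) d\<mu>(y)\<close>. This is a convex function of \<open>v\<close> whose gradient at \<open>v\<close>
  is minus the integral of \<open>y - x\<close> over the halfspace \<open>H\<^sub>v = {y. (y - x) \<bullet> v \<le> 1}\<close> (the whole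
  space if \<open>v = 0\<close>): the integrand has its kink on the boundary of \<open>H\<^sub>v\<close>, which is a null set.
  Since \<open>x\<close> is an interior point of the convex hull of the support, every open halfspace with \<open>x\<close>
  on its boundary has positive mass, so \<open>F\<close> grows at least linearly and attains its minimum.
  At a minimiser \<open>v\<close> the gradient vanishes, that is, \<open>H\<^sub>v\<close> has barycenter \<open>x\<close>; and \<open>v \<noteq> 0\<close> because \<open>x\<close>
  is not the barycenter of the whole space.

  Every halfspace with barycenter \<open>x\<close> is some \<open>H\<^sub>v\<close>, and it is maximal by a bathtub argument: \<open>H\<^sub>v\<close> is
  the set on which \<open>1 - (y - x) \<bullet> v\<close> is nonnegative, so it maximises the integral of this function over
  sets \<open>A\<close>, and for a set \<open>A\<close> with barycenter \<open>x\<close> this integral is just \<open>\<mu>(A)\<close>. Equality forces \<open>A\<close>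
  and \<open>H\<^sub>v\<close> to agree up to a null set. Hence two halfspaces with barycenter \<open>x\<close> differ by a null set,
  and if they were distinct, an open part of their symmetric difference would accumulate at every
  boundary point of the first, which is impossible at an interior point of the support.
\<close>

section \<open>Measures with finite first moment\<close>

locale first_moment_measure = finite_measure \<mu> for \<mu> :: "'a::euclidean_space measure" +
  assumes sets_borel: "sets \<mu> = sets borel"
    and abs_cont: "absolutely_continuous lborel \<mu>"
    and first_moment: "integrable \<mu> (\<lambda>y. y)"
begin

lemma space_UNIV: "space \<mu> = UNIV"
  using sets_eq_imp_space_eq[OF sets_borel] by simp

lemma sets_borelI: "A \<in> sets borel \<Longrightarrow> A \<in> sets \<mu>"
  using sets_borel by simp

lemma integrable_centred: "integrable \<mu> (\<lambda>y. y - x)"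
  using first_moment by simp

lemma integrable_centred_inner: "integrable \<mu> (\<lambda>y. (y - x) \<bullet> v)"
  using integrable_centred by (rule integrable_inner_left)

lemma set_integrable_centred: "A \<in> sets \<mu> \<Longrightarrow> set_integrable \<mu> A (\<lambda>y. y - x)"
  unfolding set_integrable_def by (rule integrable_mult_indicator[OF _ integrable_centred])

lemma has_barycenter_iff:
  "has_barycenter \<mu> A x \<longleftrightarrow>
     A \<in> sets \<mu> \<and> measure \<mu> A > 0 \<and> (LINT y:A|\<mu>. y - x) = 0"
proof -
  have "(LINT y:A|\<mu>. y - x) = (LINT y:A|\<mu>. y) - measure \<mu> A *\<^sub>R x" if A: "A \<in> sets \<mu>"
  proof -
    have "(LINT y:A|\<mu>. y - x) = (LINT y:A|\<mu>. y) - (LINT y:A|\<mu>. x)"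
      using integrable_mult_indicator[OF A first_moment] integrable_mult_indicator[OF A integrable_const]
      by (intro set_integral_diff) (auto simp: set_integrable_def)
    also have "(LINT y:A|\<mu>. x) = measure \<mu> A *\<^sub>R x"
      unfolding set_lebesgue_integral_def using A
      by (intro has_bochner_integral_integral_eq has_bochner_integral_indicator)
         (auto simp: emeasure_eq_measure)
    finally show ?thesis .
  qed
  then have "barycenter \<mu> A = x \<longleftrightarrow> (LINT y:A|\<mu>. y - x) = 0"
    if "A \<in> sets \<mu>" "measure \<mu> A > 0"
    using that vector_fraction_eq_iff[of 1 "measure \<mu> A" "LINT y:A|\<mu>. y" x]
    unfolding barycenter_def by simp
  then show ?thesis
    unfolding has_barycenter_def by blast
qed

lemma hyperplane_null:
  assumes "v \<noteq> 0"
  shows "{y. (y - x) \<bullet> v = c} \<in> null_sets \<mu>"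
proof -
  have eq: "{y. (y - x) \<bullet> v = c} = {y. v \<bullet> y = c + x \<bullet> v}"
    by (auto simp: inner_diff_left inner_commute[of v])
  have "negligible {y. (y - x) \<bullet> v = c}"
    unfolding eq using assms by (intro negligible_hyperplane) auto
  then have "{y. (y - x) \<bullet> v = c} \<in> null_sets lebesgue"
    by (simp add: negligible_iff_null_sets)
  moreover have "{y. (y - x) \<bullet> v = c} \<in> sets lborel"
    by simp
  ultimately have "{y. (y - x) \<bullet> v = c} \<in> null_sets lborel"
    by (auto simp: null_sets_def)
  then show ?thesis
    using abs_cont by (auto simp: absolutely_continuous_def)
qed

lemma AE_off_hyperplane:
  assumes "v \<noteq> 0"
  shows "AE y in \<mu>. (y - x) \<bullet> v \<noteq> c"
  using AE_not_in[OF hyperplane_null[OF assms, of x c]] by simp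

lemma AE_notin_open_disjoint_support:
  assumes "open U" "AE y in \<mu>. y \<notin> U"
  shows "U \<inter> measure_support \<mu> = {}"
proof -
  have "U \<in> null_sets \<mu>"
    using assms AE_iff_null_sets[of U \<mu>] sets_borelI[of U] by simp
  then show ?thesis
    using assms(1) by (force simp: measure_support_def null_sets_def)
qed


section \<open>Halfspaces with a given barycenter are maximal\<close>

lemma set_integral_inner:
  assumes "A \<in> sets \<mu>"
  shows "(LINT y:A|\<mu>. (y - x) \<bullet> v) = (LINT y:A|\<mu>. y - x) \<bullet> v"
  using set_integrable_centred[OF assms, of x]
  unfolding set_lebesgue_integral_def set_integrable_def
  by (subst integral_inner_left[symmetric]) auto

text \<open>
  Subtracting the mean makes the linear part disappear, so mass can be compared by comparing
  integrals of the affine function \<open>1 - (y - x) \<bullet> v\<close>, whatever \<open>v\<close> is.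
\<close>

lemma integral_affine_eq_measure:
  assumes "has_barycenter \<mu> A x"
  shows "(LINT y:A|\<mu>. 1 - (y - x) \<bullet> v) = measure \<mu> A"
proof -
  have A: "A \<in> sets \<mu>" and 0: "(LINT y:A|\<mu>. y - x) = 0"
    using assms by (auto simp: has_barycenter_iff)
  have "set_integrable \<mu> A (\<lambda>y. (y - x) \<bullet> v)"
    unfolding set_integrable_def by (rule integrable_mult_indicator[OF A integrable_centred_inner])
  then have "(LINT y:A|\<mu>. 1 - (y - x) \<bullet> v) = (LINT y:A|\<mu>. 1) - (LINT y:A|\<mu>. (y - x) \<bullet> v)"
    using integrable_mult_indicator[OF A integrable_const, of "1::real"]
    by (intro set_integral_diff) (auto simp: set_integrable_def)
  also have "\<dots> = measure \<mu> A"
    using A 0 set_integral_inner[OF A, of x v] by (simp add: set_lebesgue_integral_def space_UNIV)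
  finally show ?thesis .
qed

text \<open>
  A halfspace with barycenter \<open>x\<close> has \<open>x\<close> in its interior, since otherwise \<open>y - x\<close> would point
  strictly to one side for almost every \<open>y\<close> in it and could not average to zero. So its inequality
  can be scaled to have right-hand side \<open>1\<close>.
\<close>

lemma barycentric_halfspace_normal_form:
  assumes "closed_halfspace H" and b: "has_barycenter \<mu> H x"
  obtains v where "v \<noteq> 0" "H = {y. (y - x) \<bullet> v \<le> 1}"
proof -
  obtain \<theta> c where \<theta>: "norm \<theta> = 1" and H: "H = {y. y \<bullet> \<theta> \<le> c}"
    using assms(1) unfolding closed_halfspace_def by auto
  define t where "t = c - x \<bullet> \<theta>"
  have Ht: "H = {y. (y - x) \<bullet> \<theta> \<le> t}"
    by (auto simp: H t_def inner_diff_left)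
  have A: "H \<in> sets \<mu>" and pos: "measure \<mu> H > 0" and 0: "(LINT y:H|\<mu>. y - x) = 0"
    using b by (auto simp: has_barycenter_iff)
  have "t > 0"
  proof (rule ccontr)
    assume "\<not> t > 0"
    have int: "integrable \<mu> (\<lambda>y. indicator H y *\<^sub>R (- ((y - x) \<bullet> \<theta>)))"
      using integrable_mult_indicator[OF A integrable_minus[OF integrable_centred_inner]] .
    have "(LINT y|\<mu>. indicator H y *\<^sub>R (- ((y - x) \<bullet> \<theta>))) = 0"
      using set_integral_inner[OF A, of x \<theta>] 0 by (simp add: set_lebesgue_integral_def)
    moreover have "AE y in \<mu>. 0 \<le> indicator H y *\<^sub>R (- ((y - x) \<bullet> \<theta>))"
      using \<open>\<not> t > 0\<close> by (auto simp: Ht indicator_def)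
    ultimately have "AE y in \<mu>. indicator H y *\<^sub>R (- ((y - x) \<bullet> \<theta>)) = 0"
      using integral_nonneg_eq_0_iff_AE[OF int] by blast
    moreover have "AE y in \<mu>. (y - x) \<bullet> \<theta> \<noteq> 0"
      using \<theta> by (intro AE_off_hyperplane) auto
    ultimately have "AE y in \<mu>. y \<notin> H"
      by eventually_elim (auto simp: indicator_def split: if_splits)
    then have "H \<in> null_sets \<mu>"
      using A AE_iff_null_sets by blast
    then show False
      using pos by (simp add: measure_eq_0_null_sets)
  qed
  then have "\<theta> /\<^sub>R t \<noteq> 0" "H = {y. (y - x) \<bullet> (\<theta> /\<^sub>R t) \<le> 1}"
    using \<theta> by (auto simp: Ht field_simps)
  then show ?thesis by (rule that)
qed

text \<open>
  The two factors of \<open>g\<close> never have opposite signs, because \<open>H\<close> is exactly the set where the affine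
  factor is nonnegative. So \<open>H\<close> has at least the mass of \<open>A\<close>, and when the masses agree \<open>g\<close>, being
  nonnegative with integral zero, vanishes almost everywhere.
\<close>

lemma bathtub:
  assumes H: "H = {y. (y - x) \<bullet> v \<le> 1}"
    and bH: "has_barycenter \<mu> H x" and bA: "has_barycenter \<mu> A x"
  defines "g \<equiv> \<lambda>y. (indicator H y - indicator A y) * (1 - (y - x) \<bullet> v)"
  shows "integrable \<mu> g" "\<And>y. 0 \<le> g y" "(LINT y|\<mu>. g y) = measure \<mu> H - measure \<mu> A"
proof -
  have int: "integrable \<mu> (\<lambda>y. indicator B y * (1 - (y - x) \<bullet> v))" if "B \<in> sets \<mu>" for B
    using integrable_mult_indicator[OF that, of "\<lambda>y. 1 - (y - x) \<bullet> v"] integrable_centred_inner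
    by simp
  have sets: "H \<in> sets \<mu>" "A \<in> sets \<mu>"
    using bH bA by (auto simp: has_barycenter_iff)
  have geq: "g = (\<lambda>y. indicator H y * (1 - (y - x) \<bullet> v) - indicator A y * (1 - (y - x) \<bullet> v))"
    by (simp add: g_def left_diff_distrib)
  show "integrable \<mu> g"
    unfolding geq using sets by (intro Bochner_Integration.integrable_diff int)
  show "0 \<le> g y" for y
    by (auto simp: g_def H indicator_def)
  show "(LINT y|\<mu>. g y) = measure \<mu> H - measure \<mu> A"
    using integral_affine_eq_measure[OF bH, of v] integral_affine_eq_measure[OF bA, of v]
    unfolding geq using sets
    by (subst Bochner_Integration.integral_diff[OF int int])
       (auto simp: set_lebesgue_integral_def)
qed

lemma measure_le_barycentric_halfspace:
  assumes "closed_halfspace H" "has_barycenter \<mu> H x" "has_barycenter \<mu> A x"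
  shows "measure \<mu> A \<le> measure \<mu> H"
proof -
  obtain v where "H = {y. (y - x) \<bullet> v \<le> 1}"
    using barycentric_halfspace_normal_form assms(1,2) by blast
  note g = bathtub[OF this assms(2,3)]
  have "0 \<le> measure \<mu> H - measure \<mu> A"
    unfolding g(3)[symmetric] by (rule Bochner_Integration.integral_nonneg) (rule g(2))
  then show ?thesis by simp
qed

lemma maximal_halfspaceI:
  assumes "closed_halfspace H" "has_barycenter \<mu> H x"
  shows "maximal_halfspace \<mu> x H"
  unfolding maximal_halfspace_def
  using assms measure_le_barycentric_halfspace[OF assms]
  by (auto intro!: cSup_eq_maximum[symmetric])


section \<open>Uniqueness\<close>

lemma barycentric_halfspaces_ae_equal:
  assumes "closed_halfspace H" "has_barycenter \<mu> H x"
    and "closed_halfspace H'" "has_barycenter \<mu> H' x"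
  shows "AE y in \<mu>. y \<in> H \<longleftrightarrow> y \<in> H'"
proof -
  obtain v where v: "v \<noteq> 0" and H: "H = {y. (y - x) \<bullet> v \<le> 1}"
    using barycentric_halfspace_normal_form assms(1,2) by blast
  have "measure \<mu> H = measure \<mu> H'"
    using measure_le_barycentric_halfspace assms by (meson order_antisym)
  then have "AE y in \<mu>. (indicator H y - indicator H' y) * (1 - (y - x) \<bullet> v) = (0::real)"
    using bathtub[OF H assms(2,4)] by (subst integral_nonneg_eq_0_iff_AE[symmetric]) auto
  with AE_off_hyperplane[OF v, of x 1] show ?thesis
    by eventually_elim (auto simp: indicator_def split: if_splits)
qed

lemma frontier_affine_halfspace:
  fixes v x :: 'a
  assumes "v \<noteq> 0"
  shows "frontier {y. (y - x) \<bullet> v \<le> 1} = {y. (y - x) \<bullet> v = 1}"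
proof -
  have "{y. (y - x) \<bullet> v \<le> 1} = {y. v \<bullet> y \<le> 1 + x \<bullet> v}"
    "{y. (y - x) \<bullet> v = 1} = {y. v \<bullet> y = 1 + x \<bullet> v}"
    by (auto simp: inner_diff_left inner_commute[of v])
  then show ?thesis
    using frontier_halfspace_le[of v "1 + x \<bullet> v"] assms by simp
qed

text \<open>
  The proof finds a direction \<open>w\<close> along which one leaves \<open>p\<close> into the symmetric difference. If \<open>p\<close>
  lies on only one of the two hyperplanes, moving towards \<open>x\<close> or away from it is enough. If it lies
  on both, the slope along \<open>v' - v\<close> is larger for \<open>v'\<close> than for \<open>v\<close>, and adding a multiple of \<open>p - x\<close>,
  which changes both slopes equally, puts zero strictly between them.
\<close>

lemma distinct_halfspaces_differ_near:
  fixes v v' x p :: 'a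
  assumes "v \<noteq> v'" and p: "(p - x) \<bullet> v = 1" and "r > 0"
  defines "U \<equiv> {y. (y - x) \<bullet> v < 1 \<and> (y - x) \<bullet> v' > 1} \<union> {y. (y - x) \<bullet> v > 1 \<and> (y - x) \<bullet> v' < 1}"
  shows "U \<inter> ball p r \<noteq> {}"
proof -
  have "\<exists>w. \<forall>\<^sub>F e in at_right 0. p + e *\<^sub>R w \<in> U"
  proof -
    have lim: "((\<lambda>e. (p + e *\<^sub>R w - x) \<bullet> v') \<longlongrightarrow> (p - x) \<bullet> v') (at_right (0::real))" for w
      by (auto intro!: tendsto_eq_intros)
    have pos: "\<forall>\<^sub>F e in at_right 0. e > (0::real)"
      by (rule eventually_at_right_less)
    consider "(p - x) \<bullet> v' > 1" | "(p - x) \<bullet> v' < 1" | "(p - x) \<bullet> v' = 1" by linarith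
    then show ?thesis
    proof cases
      case 1
      from order_tendstoD(1)[OF lim[of "x - p"] 1] pos
      have "\<forall>\<^sub>F e in at_right 0. p + e *\<^sub>R (x - p) \<in> U"
      proof eventually_elim
        case (elim e)
        have "(p + e *\<^sub>R (x - p) - x) \<bullet> v = (1 - e) * ((p - x) \<bullet> v)"
          by (simp add: algebra_simps)
        then show ?case using elim p by (simp add: U_def)
      qed
      then show ?thesis ..
    next
      case 2
      from order_tendstoD(2)[OF lim[of "p - x"] 2] pos
      have "\<forall>\<^sub>F e in at_right 0. p + e *\<^sub>R (p - x) \<in> U"
      proof eventually_elim
        case (elim e)
        have "(p + e *\<^sub>R (p - x) - x) \<bullet> v = (1 + e) * ((p - x) \<bullet> v)"
          by (simp add: algebra_simps)
        then show ?case using elim p by (simp add: U_def)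
      qed
      then show ?thesis ..
    next
      case 3
      define s where "s = ((v' - v) \<bullet> v + (v' - v) \<bullet> v') / 2"
      define w where "w = (v' - v) - s *\<^sub>R (p - x)"
      have "(v' - v) \<bullet> v' - (v' - v) \<bullet> v > 0"
        using assms(1) by (simp add: inner_diff_right[symmetric])
      then have w: "w \<bullet> v < 0" "w \<bullet> v' > 0"
        using p 3 by (simp_all add: w_def s_def inner_diff_left[of "v' - v"])
      have "p + e *\<^sub>R w \<in> U" if "e > 0" for e
      proof -
        have "(p + e *\<^sub>R w - x) \<bullet> u = (p - x) \<bullet> u + e * (w \<bullet> u)" for u
          by (simp add: algebra_simps)
        then show ?thesis
          using that w p 3 by (simp add: U_def mult_pos_neg)
      qed
      then have "\<forall>\<^sub>F e in at_right 0. p + e *\<^sub>R w \<in> U"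
        by (rule eventually_mono[OF pos])
      then show ?thesis ..
    qed
  qed
  then obtain w where w: "\<forall>\<^sub>F e in at_right 0. p + e *\<^sub>R w \<in> U" ..
  have "((\<lambda>e. p + e *\<^sub>R w) \<longlongrightarrow> p) (at_right (0::real))"
    by (auto intro!: tendsto_eq_intros)
  then have "\<forall>\<^sub>F e in at_right (0::real). p + e *\<^sub>R w \<in> ball p r"
    using \<open>r > 0\<close> by (intro topological_tendstoD) auto
  with w have "\<forall>\<^sub>F e in at_right (0::real). p + e *\<^sub>R w \<in> U \<inter> ball p r"
    by eventually_elim simp
  then obtain e where "p + e *\<^sub>R w \<in> U \<inter> ball p r"
    using eventually_happens'[OF trivial_limit_at_right_real] by blast
  then show ?thesis by blast
qed

lemma barycentric_halfspace_unique:
  assumes "closed_halfspace H" "has_barycenter \<mu> H x"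
    and "closed_halfspace H'" "has_barycenter \<mu> H' x"
    and "frontier H \<inter> interior (measure_support \<mu>) \<noteq> {}"
  shows "H' = H"
proof -
  obtain v where v: "v \<noteq> 0" and H: "H = {y. (y - x) \<bullet> v \<le> 1}"
    using barycentric_halfspace_normal_form assms(1,2) by blast
  obtain v' where H': "H' = {y. (y - x) \<bullet> v' \<le> 1}"
    using barycentric_halfspace_normal_form assms(3,4) by blast
  obtain p where p: "(p - x) \<bullet> v = 1" and ps: "p \<in> interior (measure_support \<mu>)"
    using assms(5) unfolding H frontier_affine_halfspace[OF v] by auto
  then obtain r where r: "r > 0" "ball p r \<subseteq> measure_support \<mu>"
    by (auto simp: mem_interior)
  have "v = v'"
  proof (rule ccontr)
    assume "v \<noteq> v'"
    define U where
      "U = {y. (y - x) \<bullet> v < 1 \<and> (y - x) \<bullet> v' > 1} \<union> {y. (y - x) \<bullet> v > 1 \<and> (y - x) \<bullet> v' < 1}"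
    obtain z where "z \<in> U" "z \<in> measure_support \<mu>"
      using distinct_halfspaces_differ_near[OF \<open>v \<noteq> v'\<close> p r(1)] r(2) by (auto simp: U_def)
    moreover have "open U"
      unfolding U_def by (intro open_Un open_Collect_conj open_Collect_less continuous_intros)
    moreover have "AE y in \<mu>. y \<notin> U"
      using barycentric_halfspaces_ae_equal[OF assms(1-4)]
      by eventually_elim (auto simp: U_def H H')
    ultimately show False
      using AE_notin_open_disjoint_support[of U] by blast
  qed
  then show ?thesis by (simp add: H H')
qed


section \<open>Existence by minimising a convex functional\<close>

text \<open>
  At level \<open>1\<close> this is the functional to be minimised; at level \<open>0\<close> it is the asymptotic slope
  of that functional, which is positively homogeneous and bounds the functional from below.
\<close>

definition excess :: "real \<Rightarrow> 'a \<Rightarrow> 'a \<Rightarrow> real" where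
  "excess c x v = (LINT y|\<mu>. max 0 (c - (y - x) \<bullet> v))"

lemma integrable_excess: "integrable \<mu> (\<lambda>y. max 0 (c - (y - x) \<bullet> v))"
  by (intro integrable_max Bochner_Integration.integrable_diff integrable_centred_inner) auto

lemma continuous_on_excess: "continuous_on S (excess c x)"
proof -
  define L where "L = (LINT y|\<mu>. norm (y - x))"
  have L: "L \<ge> 0" by (simp add: L_def)
  have "dist (excess c x v) (excess c x w) \<le> L * dist v w" for v w
  proof -
    have "norm (excess c x v - excess c x w)
        = norm (LINT y|\<mu>. max 0 (c - (y - x) \<bullet> v) - max 0 (c - (y - x) \<bullet> w))"
      unfolding excess_def by (simp add: integrable_excess)
    also have "\<dots> \<le> (LINT y|\<mu>. norm (y - x) * norm (v - w))"
    proof (rule Bochner_Integration.integral_norm_bound_integral)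
      fix y
      have "norm (max 0 (c - (y - x) \<bullet> v) - max 0 (c - (y - x) \<bullet> w)) \<le> \<bar>(y - x) \<bullet> (v - w)\<bar>"
        by (auto simp: inner_diff_right max_def)
      also have "\<dots> \<le> norm (y - x) * norm (v - w)"
        by (rule Cauchy_Schwarz_ineq2)
      finally show "norm (max 0 (c - (y - x) \<bullet> v) - max 0 (c - (y - x) \<bullet> w))
          \<le> norm (y - x) * norm (v - w)" .
    qed (use integrable_centred in \<open>auto intro!: Bochner_Integration.integrable_diff integrable_excess\<close>)
    finally show ?thesis by (simp add: L_def dist_norm)
  qed
  then have "L-lipschitz_on S (excess c x)"
    using L by (auto intro!: lipschitz_onI)
  then show ?thesis
    by (rule lipschitz_on_continuous_on)
qed

lemma excess_0_scale:
  assumes "t \<ge> 0"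
  shows "excess 0 x (t *\<^sub>R v) = t * excess 0 x v"
proof -
  have "max 0 (0 - (y - x) \<bullet> (t *\<^sub>R v)) = t * max 0 (0 - (y - x) \<bullet> v)" for y
    using max_mult_distrib_left[of t 0 "0 - (y - x) \<bullet> v"] assms by simp
  then show ?thesis
    unfolding excess_def by simp
qed

lemma excess_mono: "c \<le> d \<Longrightarrow> excess c x v \<le> excess d x v"
  unfolding excess_def by (intro integral_mono integrable_excess) auto

text \<open>
  A vanishing slope in the direction \<open>v\<close> would confine the support, and hence its convex hull, to the
  side of the hyperplane through \<open>x\<close> where \<open>(y - x) \<bullet> v \<ge> 0\<close>, putting \<open>x\<close> on the boundary.
\<close>

lemma excess_0_pos:
  assumes x: "x \<in> interior (convex hull (measure_support \<mu>))" and "v \<noteq> 0"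
  shows "excess 0 x v > 0"
proof (rule ccontr)
  assume "\<not> excess 0 x v > 0"
  moreover have "excess 0 x v \<ge> 0"
    unfolding excess_def by simp
  ultimately have "excess 0 x v = 0" by linarith
  then have AE: "AE y in \<mu>. max 0 (0 - (y - x) \<bullet> v) = 0"
    unfolding excess_def by (subst (asm) integral_nonneg_eq_0_iff_AE[OF integrable_excess]) auto
  define U where "U = {y. (y - x) \<bullet> v < 0}"
  have U: "open U"
    unfolding U_def by (intro open_Collect_less continuous_intros)
  have "AE y in \<mu>. y \<notin> U"
    using AE by eventually_elim (auto simp: U_def)
  then have "measure_support \<mu> \<subseteq> - U"
    using AE_notin_open_disjoint_support[OF U] by blast
  moreover have "- U = {y. v \<bullet> y \<ge> v \<bullet> x}"
    by (auto simp: U_def inner_diff_left inner_commute[of v])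
  ultimately have "convex hull (measure_support \<mu>) \<subseteq> {y. v \<bullet> y \<ge> v \<bullet> x}"
    using convex_halfspace_ge by (metis hull_minimal)
  then have "x \<in> interior {y. v \<bullet> y \<ge> v \<bullet> x}"
    using x interior_mono by blast
  then show False
    using interior_halfspace_ge[OF \<open>v \<noteq> 0\<close>, of "v \<bullet> x"] by simp
qed

text \<open>
  The slope is continuous and positive on the compact unit sphere, so it has a positive minimum \<open>m\<close>
  there and the functional at \<open>w\<close> is at least \<open>m * norm w\<close>; a minimum over a large ball is then global.
\<close>

lemma excess_attains_minimum:
  assumes x: "x \<in> interior (convex hull (measure_support \<mu>))"
  obtains v where "\<And>w. excess 1 x v \<le> excess 1 x w"
proof -
  have "sphere (0::'a) 1 \<noteq> {}"
    by simp
  then obtain u where u: "u \<in> sphere 0 1" "\<And>w. w \<in> sphere 0 1 \<Longrightarrow> excess 0 x u \<le> excess 0 x w"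
    using continuous_attains_inf[OF compact_sphere _ continuous_on_excess] by metis
  define m where "m = excess 0 x u"
  have m: "m > 0"
    unfolding m_def using u(1) by (intro excess_0_pos[OF x]) auto
  have growth: "m * norm w \<le> excess 1 x w" for w
  proof (cases "w = 0")
    case True
    then show ?thesis by (simp add: excess_def)
  next
    case False
    have "m * norm w \<le> norm w * excess 0 x (w /\<^sub>R norm w)"
      using u(2)[of "w /\<^sub>R norm w"] False by (simp add: m_def mult.commute mult_left_mono)
    also have "\<dots> = excess 0 x w"
      using excess_0_scale[of "norm w" x "w /\<^sub>R norm w"] False by simp
    also have "\<dots> \<le> excess 1 x w"
      by (intro excess_mono) simp
    finally show ?thesis .
  qed
  \<comment> \<open>Outside the ball of this radius the functional exceeds its value at the origin.\<close>
  define R where "R = excess 1 x 0 / m"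
  have "R \<ge> 0"
    using m by (simp add: R_def excess_def)
  then obtain v where v: "\<And>w. w \<in> cball 0 R \<Longrightarrow> excess 1 x v \<le> excess 1 x w"
    using continuous_attains_inf[OF compact_cball _ continuous_on_excess, of 0 R]
    by (metis cball_eq_empty not_le)
  have "excess 1 x v \<le> excess 1 x w" for w
  proof (cases "w \<in> cball 0 R")
    case False
    have "excess 1 x v \<le> excess 1 x 0"
      using v \<open>R \<ge> 0\<close> by simp
    also have "\<dots> \<le> m * norm w"
      using False m by (simp add: R_def field_simps)
    finally show ?thesis using growth[of w] by linarith
  qed (rule v)
  then show ?thesis by (rule that)
qed

text \<open>
  The first-order condition at a minimiser. Instead of differentiating under the integral, use the
  subgradient inequality at the nearby point \<open>v + e w\<close>, whose halfspace enters through its indicator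
  only, and let \<open>e\<close> tend to zero: the indicators converge off the bounding hyperplane of \<open>H\<^sub>v\<close>.
\<close>

lemma excess_minimum_stationary:
  assumes min: "\<And>w. excess 1 x v \<le> excess 1 x w"
  shows "(LINT y:{y. (y - x) \<bullet> v \<le> 1}|\<mu>. y - x) = 0"
proof -
  define H where "H u = {y. (y - x) \<bullet> u \<le> 1}" for u
  have H: "H u \<in> sets \<mu>" for u
    unfolding H_def by (intro sets_borelI borel_closed closed_Collect_le continuous_intros)
  have int: "integrable \<mu> (\<lambda>y. indicator (H u) y * ((y - x) \<bullet> w))" for u w
    using integrable_mult_indicator[OF H integrable_centred_inner, of u x w] by simp
  have le0: "(LINT y|\<mu>. indicator (H v) y * ((y - x) \<bullet> w)) \<le> 0" for w
  proof -
    define e where "e n = inverse (real (Suc n))" for n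
    have e: "e n > 0" for n
      by (simp add: e_def)
    have "(LINT y|\<mu>. indicator (H (v + e n *\<^sub>R w)) y * ((y - x) \<bullet> w)) \<le> 0" for n
    proof -
      let ?u = "v + e n *\<^sub>R w"
      have "excess 1 x ?u - excess 1 x v
          = (LINT y|\<mu>. max 0 (1 - (y - x) \<bullet> ?u) - max 0 (1 - (y - x) \<bullet> v))"
        unfolding excess_def using integrable_excess by simp
      also have "\<dots> \<le> (LINT y|\<mu>. - e n * (indicator (H ?u) y * ((y - x) \<bullet> w)))"
        by (intro integral_mono Bochner_Integration.integrable_diff integrable_excess
              integrable_mult_right int)
           (auto simp: H_def indicator_def inner_add_right max_def)
      also have "\<dots> = - e n * (LINT y|\<mu>. indicator (H ?u) y * ((y - x) \<bullet> w))"
        by simp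
      finally have "0 \<le> - e n * (LINT y|\<mu>. indicator (H ?u) y * ((y - x) \<bullet> w))"
        using min[of ?u] by linarith
      then show ?thesis
        using e[of n] by (simp add: mult_le_0_iff)
    qed
    moreover have "(\<lambda>n. LINT y|\<mu>. indicator (H (v + e n *\<^sub>R w)) y * ((y - x) \<bullet> w))
        \<longlonglongrightarrow> (LINT y|\<mu>. indicator (H v) y * ((y - x) \<bullet> w))"
    proof (rule integral_dominated_convergence[where w = "\<lambda>y. \<bar>(y - x) \<bullet> w\<bar>"])
      have "AE y in \<mu>. (y - x) \<bullet> v \<noteq> 1"
        by (cases "v = 0") (auto intro!: AE_off_hyperplane)
      then show "AE y in \<mu>. (\<lambda>n. indicator (H (v + e n *\<^sub>R w)) y * ((y - x) \<bullet> w))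
          \<longlonglongrightarrow> indicator (H v) y * ((y - x) \<bullet> w)"
      proof eventually_elim
        case (elim y)
        have "e \<longlonglongrightarrow> 0"
          unfolding e_def by (rule LIMSEQ_inverse_real_of_nat)
        then have lim: "(\<lambda>n. (y - x) \<bullet> (v + e n *\<^sub>R w)) \<longlonglongrightarrow> (y - x) \<bullet> v"
          by (auto intro!: tendsto_eq_intros)
        have "\<forall>\<^sub>F n in sequentially.
            indicator (H (v + e n *\<^sub>R w)) y = (indicator (H v) y :: real)"
        proof (cases "(y - x) \<bullet> v < 1")
          case True
          from order_tendstoD(2)[OF lim True] show ?thesis
            by eventually_elim (use True in \<open>auto simp: H_def indicator_def\<close>)
        next
          case False
          with elim have "(y - x) \<bullet> v > 1" by linarith
          from order_tendstoD(1)[OF lim this] show ?thesis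
            by eventually_elim (use False elim in \<open>auto simp: H_def indicator_def\<close>)
        qed
        then show ?case
          by (intro tendsto_eventually) (auto elim: eventually_mono)
      qed
    qed (use int integrable_centred_inner in \<open>auto simp: indicator_def\<close>)
    ultimately show ?thesis
      by (intro LIMSEQ_le_const2) auto
  qed
  \<comment> \<open>Test the inequality with the integral itself as the direction.\<close>
  define z where "z = (LINT y:H v|\<mu>. y - x)"
  have "z \<bullet> z = (LINT y:H v|\<mu>. (y - x) \<bullet> z)"
    using set_integral_inner[OF H, of v x z] by (simp add: z_def)
  also have "\<dots> \<le> 0"
    using le0[of z] by (simp add: set_lebesgue_integral_def)
  finally have "z = 0"
    by (metis inner_eq_zero_iff inner_ge_zero order_antisym)
  then show ?thesis
    by (simp add: z_def H_def)
qed

lemma barycentric_halfspace_exists: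
  assumes x: "x \<in> interior (convex hull (measure_support \<mu>))" and ne: "x \<noteq> barycenter \<mu> UNIV"
  obtains H where "closed_halfspace H" "has_barycenter \<mu> H x"
proof -
  obtain v where min: "\<And>w. excess 1 x v \<le> excess 1 x w"
    using excess_attains_minimum[OF x] by blast
  define H where "H = {y. (y - x) \<bullet> v \<le> 1}"
  have 0: "(LINT y:H|\<mu>. y - x) = 0"
    unfolding H_def by (rule excess_minimum_stationary[OF min])
  have H: "H \<in> sets \<mu>"
    unfolding H_def by (intro sets_borelI borel_closed closed_Collect_le continuous_intros)
  have "measure_support \<mu> \<noteq> {}"
    using x by auto
  then have UNIV_pos: "measure \<mu> UNIV > 0"
    by (force simp: measure_support_def emeasure_eq_measure)
  have "v \<noteq> 0"
  proof
    assume "v = 0"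
    then have "H = UNIV" by (simp add: H_def)
    then have "has_barycenter \<mu> UNIV x"
      using 0 H UNIV_pos by (simp add: has_barycenter_iff)
    then show False
      using ne by (simp add: has_barycenter_def)
  qed
  have "measure \<mu> H > 0"
  proof (rule ccontr)
    assume "\<not> measure \<mu> H > 0"
    then have "H \<in> null_sets \<mu>"
      using H by (auto simp: null_sets_def emeasure_eq_measure less_le)
    from AE_not_in[OF this] have "AE y in \<mu>. max 0 (1 - (y - x) \<bullet> v) = 0"
      by eventually_elim (simp add: H_def)
    then have "excess 1 x v = 0"
      unfolding excess_def by (rule integral_eq_zero_AE)
    then show False
      using excess_mono[of 0 1 x v] excess_0_pos[OF x \<open>v \<noteq> 0\<close>] by simp
  qed
  with 0 H have "has_barycenter \<mu> H x"
    by (simp add: has_barycenter_iff)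
  moreover have "closed_halfspace H"
    unfolding closed_halfspace_def
  proof (intro exI conjI)
    show "norm (v /\<^sub>R norm v) = 1"
      using \<open>v \<noteq> 0\<close> by simp
    show "H = {y. y \<bullet> (v /\<^sub>R norm v) \<le> (1 + x \<bullet> v) / norm v}"
      using \<open>v \<noteq> 0\<close> by (auto simp: H_def inner_diff_left field_simps)
  qed
  ultimately show ?thesis using that by blast
qed

end


section \<open>The theorem\<close>

theorem theorem1p1:
  fixes \<mu> :: "(real ^ 'n) measure" and x :: "real ^ 'n"
  assumes "finite_measure \<mu>"
    and "sets \<mu> = sets borel"
    and "absolutely_continuous lborel \<mu>"
    and "(\<integral>\<^sup>+ y. ennreal (norm y) \<partial>\<mu>) < \<infinity>"
    and "x \<in> interior (convex hull (measure_support \<mu>))"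
    and "x \<noteq> barycenter \<mu> UNIV"
  shows "(\<exists>H. maximal_halfspace \<mu> x H) \<and>
         (\<forall>H. maximal_halfspace \<mu> x H \<and> frontier H \<inter> interior (measure_support \<mu>) \<noteq> {} \<longrightarrow>
              (\<forall>H'. closed_halfspace H' \<and> has_barycenter \<mu> H' x \<longrightarrow> H' = H))"
proof -
  have "(\<lambda>y. y) \<in> borel_measurable \<mu>"
    using measurable_ident_sets[OF assms(2)] .
  then have "integrable \<mu> (\<lambda>y. y)"
    using assms(4) by (simp add: integrable_iff_bounded)
  then interpret first_moment_measure \<mu>
    using assms(1-3) by (simp add: first_moment_measure_def first_moment_measure_axioms_def)
  obtain H where "closed_halfspace H" "has_barycenter \<mu> H x"
    using barycentric_halfspace_exists[OF assms(5,6)] by blast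
  then have "maximal_halfspace \<mu> x H"
    by (rule maximal_halfspaceI)
  moreover have "H' = K"
    if "maximal_halfspace \<mu> x K" "frontier K \<inter> interior (measure_support \<mu>) \<noteq> {}"
      and "closed_halfspace H'" "has_barycenter \<mu> H' x" for K H'
    using that barycentric_halfspace_unique[of K x H'] by (simp add: maximal_halfspace_def)
  ultimately show ?thesis by blast
qed

end
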